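(* Any cell probe data structure with cell size $w$ bits solving the indexing problem (with $k$ strings of length $n$) with a non-adaptive query algorithm must either have query time $t_q = \Omega(n/w)$ or update time $t_u = \Omega(k/w)$, regardless of the preprocessing time and space usage.
   Context: **Cell probe model.** A data structure consists of a collection of memory cells, each storing $w$ bits and each having an integer address in $[2^w]=\{1,\dots,2^w\}$. In a preprocessing phase the data structure receives an input and initializes its cells (with unrestricted computation). A query algorithm, given a query, probes (reads) cells one at a time; the cell probed at each step may in general depend arbitrarily on the query and the contents of all cells probed so far; after probing some cells it terminates with the answer. An update algorithm, given an update, reads and/or writes cells (both are called probing); the cell probed and the contents written at each step may in general depend arbitrarily on the update and the contents of the cells probed so far. Only probes are charged: the query time $t_q$ and update time $t_u$ are the (worst-case) numbers of cells probed when answering a query, respectively processing an update. The space usage is the largest address used. Data structures are deterministic and always correct. **Non-adaptive query algorithm.** The cells probed when answering a query depend only on the query, and not on the contents of previously probed cells. The update algorithm is unrestricted (it may be adaptive). **Indexing problem.** In a preprocessing phase, we receive $k$ binary strings $S_1,\dots,S_k$, each of length $n$. We then support updates, each consisting of an index $j\in[n]$. A query is specified by an index $i\in[k]$, and the goal is to return the $j$'th bit of $S_i$, where $j$ is the index given in the most recent update. **Asymptotics.** The $\Omega(\cdot)$ hides an absolute positive constant: there is a constant $c>0$, independent of $n,k,w$ and of the data structure, such that $t_q\ge c\,n/w$ or $t_u\ge c\,k/w$. *)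

theory Defs
  imports Complex_Main
begin

type_synonym cell = "bool list"
type_synonym memory = "nat \<Rightarrow> cell"

definition words :: "nat \<Rightarrow> cell set" where
  "words w = {c. length c = w}"

definition addresses :: "nat \<Rightarrow> nat set" where
  "addresses w = {1..2 ^ w}"

text \<open>The values of a memory outside the address range are junk: well-formed algorithms
  never look at them.\<close>

definition memories :: "nat \<Rightarrow> memory set" where
  "memories w = {m. \<forall>a\<in>addresses w. m a \<in> words w}"

text \<open>Algorithms are decision trees, so that the next step may depend arbitrarily on the
  contents read so far; every run is finite.\<close>

datatype query_alg =
    Answer bool
  | Probe nat "cell \<Rightarrow> query_alg"

datatype update_alg =
    Done
  | Read nat "cell \<Rightarrow> update_alg"
  | Write nat cell update_alg

primrec wf_query :: "nat \<Rightarrow> query_alg \<Rightarrow> bool" where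
  "wf_query w (Answer b) \<longleftrightarrow> True"
| "wf_query w (Probe a f) \<longleftrightarrow> a \<in> addresses w \<and> (\<forall>c. c \<in> words w \<longrightarrow> wf_query w (f c))"

primrec wf_update :: "nat \<Rightarrow> update_alg \<Rightarrow> bool" where
  "wf_update w Done \<longleftrightarrow> True"
| "wf_update w (Read a f) \<longleftrightarrow> a \<in> addresses w \<and> (\<forall>c. c \<in> words w \<longrightarrow> wf_update w (f c))"
| "wf_update w (Write a c p) \<longleftrightarrow> a \<in> addresses w \<and> c \<in> words w \<and> wf_update w p"

primrec run_query :: "query_alg \<Rightarrow> memory \<Rightarrow> bool" where
  "run_query (Answer b) m = b"
| "run_query (Probe a f) m = run_query (f (m a)) m"

primrec query_cells :: "query_alg \<Rightarrow> memory \<Rightarrow> nat set" where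
  "query_cells (Answer b) m = {}"
| "query_cells (Probe a f) m = insert a (query_cells (f (m a)) m)"

primrec run_update :: "update_alg \<Rightarrow> memory \<Rightarrow> memory" where
  "run_update Done m = m"
| "run_update (Read a f) m = run_update (f (m a)) m"
| "run_update (Write a c p) m = run_update p (m(a := c))"

primrec update_cells :: "update_alg \<Rightarrow> memory \<Rightarrow> nat set" where
  "update_cells Done m = {}"
| "update_cells (Read a f) m = insert a (update_cells (f (m a)) m)"
| "update_cells (Write a c p) m = insert a (update_cells p (m(a := c)))"

record indexing_ds =
  preprocess :: "bool list list \<Rightarrow> memory"
  update :: "nat \<Rightarrow> update_alg"
  query :: "nat \<Rightarrow> query_alg"

definition inputs :: "nat \<Rightarrow> nat \<Rightarrow> bool list list set" where
  "inputs k n = {S. length S = k \<and> (\<forall>s\<in>set S. length s = n)}"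

definition cell_probe_ds :: "nat \<Rightarrow> nat \<Rightarrow> nat \<Rightarrow> indexing_ds \<Rightarrow> bool" where
  "cell_probe_ds w k n D \<longleftrightarrow>
     (\<forall>S\<in>inputs k n. preprocess D S \<in> memories w) \<and>
     (\<forall>j\<in>{1..n}. wf_update w (update D j)) \<and>
     (\<forall>i\<in>{1..k}. wf_query w (query D i))"

text \<open>The memory after preprocessing \<open>S\<close> and then processing the updates \<open>js\<close> from left to right.\<close>

definition state :: "indexing_ds \<Rightarrow> bool list list \<Rightarrow> nat list \<Rightarrow> memory" where
  "state D S js = fold (\<lambda>j. run_update (update D j)) js (preprocess D S)"

text \<open>Strings and positions are numbered from 1, list positions from 0. Queries have a specified
  answer only once there has been an update.\<close>

definition solves_indexing :: "nat \<Rightarrow> nat \<Rightarrow> nat \<Rightarrow> indexing_ds \<Rightarrow> bool" where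
  "solves_indexing w k n D \<longleftrightarrow>
     cell_probe_ds w k n D \<and>
     (\<forall>S\<in>inputs k n. \<forall>js. js \<noteq> [] \<and> set js \<subseteq> {1..n} \<longrightarrow>
        (\<forall>i\<in>{1..k}. run_query (query D i) (state D S js) = S ! (i - 1) ! (last js - 1)))"

definition nonadaptive_query :: "nat \<Rightarrow> nat \<Rightarrow> indexing_ds \<Rightarrow> bool" where
  "nonadaptive_query w k D \<longleftrightarrow>
     (\<forall>i\<in>{1..k}. \<exists>P. \<forall>m\<in>memories w. query_cells (query D i) m = P)"

text \<open>Worst-case numbers of cells probed. For a data structure satisfying
  \<open>cell_probe_ds w k n\<close> all these numbers are at most \<open>2 ^ w\<close>, so the suprema are maxima
  (or 0 if there is no operation at all). Repeated probes of one cell by the same operation are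
  charged once; the lower bound then also holds when every single access is charged.\<close>

definition query_time :: "nat \<Rightarrow> nat \<Rightarrow> indexing_ds \<Rightarrow> nat" where
  "query_time k n D =
     Sup {card (query_cells (query D i) (state D S js)) | S js i.
            S \<in> inputs k n \<and> js \<noteq> [] \<and> set js \<subseteq> {1..n} \<and> i \<in> {1..k}}"

definition update_time :: "nat \<Rightarrow> nat \<Rightarrow> indexing_ds \<Rightarrow> nat" where
  "update_time k n D =
     Sup {card (update_cells (update D j) (state D S js)) | S js j.
            S \<in> inputs k n \<and> set js \<subseteq> {1..n} \<and> j \<in> {1..n}}"

end

(* Counting. The query algorithm being non-adaptive, all queries together only ever look at a
   fixed set U of at most k t_q cells. An input is therefore determined by the contents of U after
   preprocessing and, for each of the n updates, by the addresses and new contents of t_u cells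
   including all that it probes: from these one can answer every query after every update.
   Hence k n <= k t_q w + n t_u (2 w). *)

theory Submission imports Defs "HOL-Library.FuncSet" begin

lemma finite_addresses: "finite (addresses w)"
  and card_addresses: "card (addresses w) = 2 ^ w"
  by (simp_all add: addresses_def)

lemma words_eq_lists: "words w = {xs. set xs \<subseteq> UNIV \<and> length xs = w}"
  by (simp add: words_def)

lemma finite_words: "finite (words w)"
  unfolding words_eq_lists by (rule finite_lists_length_eq) simp

lemma card_words: "card (words w) = 2 ^ w"
  unfolding words_eq_lists by (subst card_lists_length_eq) simp_all

lemma inputs_eq_lists: "inputs k n = {S. set S \<subseteq> words n \<and> length S = k}"
  by (auto simp: inputs_def words_def)

lemma card_inputs: "card (inputs k n) = 2 ^ (k * n)"
  unfolding inputs_eq_lists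
  by (simp add: card_lists_length_eq finite_words card_words mult.commute flip: power_mult)

lemma inputs_nonempty: "inputs k n \<noteq> {}"
  using card_inputs[of k n] by fastforce

lemma memories_upd: "m \<in> memories w \<Longrightarrow> c \<in> words w \<Longrightarrow> m(a := c) \<in> memories w"
  by (simp add: memories_def)

lemma memories_words: "m \<in> memories w \<Longrightarrow> a \<in> addresses w \<Longrightarrow> m a \<in> words w"
  by (simp add: memories_def)

lemma query_cells_subset_addresses:
  "wf_query w q \<Longrightarrow> m \<in> memories w \<Longrightarrow> query_cells q m \<subseteq> addresses w"
  by (induction q) (auto simp: memories_words)

text \<open>Agreement is required only on the cells probed under \<open>m\<close>: by induction the
  run on \<open>m'\<close> then reads the same contents and follows the same path of the decision
  tree.\<close>

lemma run_query_cong: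
  "(\<And>a. a \<in> query_cells q m \<Longrightarrow> m a = m' a) \<Longrightarrow> run_query q m = run_query q m'"
  by (induction q) auto

lemma update_cells_subset_addresses:
  "wf_update w p \<Longrightarrow> m \<in> memories w \<Longrightarrow> update_cells p m \<subseteq> addresses w"
  by (induction p arbitrary: m) (auto simp: memories_words memories_upd dest!: subsetD[rotated])

lemma run_update_memories:
  "wf_update w p \<Longrightarrow> m \<in> memories w \<Longrightarrow> run_update p m \<in> memories w"
  by (induction p arbitrary: m) (auto simp: memories_words memories_upd)

lemma run_update_unprobed: "a \<notin> update_cells p m \<Longrightarrow> run_update p m a = m a"
  by (induction p arbitrary: m) auto

lemma state_memories:
  assumes ds: "cell_probe_ds w k n D" and S: "S \<in> inputs k n" and "set js \<subseteq> {1..n}"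
  shows "state D S js \<in> memories w"
  using assms(3)
proof (induction js rule: rev_induct)
  case Nil
  then show ?case using ds S by (simp add: state_def cell_probe_ds_def)
next
  case (snoc j js)
  then show ?case
    using ds by (auto simp: state_def cell_probe_ds_def intro!: run_update_memories)
qed

text \<open>All probes fall into the address range and repeated probes count once. The bound makes
  the set in \<open>query_time\<close> bounded, so that its supremum really dominates every element.
  The next lemma does the same for updates.\<close>

lemma card_query_cells_le:
  assumes "cell_probe_ds w k n D" "S \<in> inputs k n" "set js \<subseteq> {1..n}" "i \<in> {1..k}"
  shows "card (query_cells (query D i) (state D S js)) \<le> 2 ^ w"
proof -
  have "query_cells (query D i) (state D S js) \<subseteq> addresses w"
    using assms state_memories[OF assms(1-3)]
    by (intro query_cells_subset_addresses) (auto simp: cell_probe_ds_def)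
  then show ?thesis
    using card_mono[OF finite_addresses] by (simp add: card_addresses)
qed

lemma card_update_cells_le:
  assumes "cell_probe_ds w k n D" "S \<in> inputs k n" "set js \<subseteq> {1..n}" "j \<in> {1..n}"
  shows "card (update_cells (update D j) (state D S js)) \<le> 2 ^ w"
proof -
  have "update_cells (update D j) (state D S js) \<subseteq> addresses w"
    using assms state_memories[OF assms(1-3)]
    by (intro update_cells_subset_addresses) (auto simp: cell_probe_ds_def)
  then show ?thesis
    using card_mono[OF finite_addresses] by (simp add: card_addresses)
qed

lemma card_query_cells_le_query_time:
  assumes "cell_probe_ds w k n D" "S \<in> inputs k n" "js \<noteq> []" "set js \<subseteq> {1..n}" "i \<in> {1..k}"
  shows "card (query_cells (query D i) (state D S js)) \<le> query_time k n D"
  unfolding query_time_def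
proof (rule cSup_upper)
  show "bdd_above {card (query_cells (query D i) (state D S js)) | S js i.
      S \<in> inputs k n \<and> js \<noteq> [] \<and> set js \<subseteq> {1..n} \<and> i \<in> {1..k}}"
    using card_query_cells_le[OF assms(1)] by (intro bdd_aboveI[of _ "2 ^ w"]) blast
qed (use assms in blast)

lemma card_update_cells_le_update_time:
  assumes "cell_probe_ds w k n D" "S \<in> inputs k n" "set js \<subseteq> {1..n}" "j \<in> {1..n}"
  shows "card (update_cells (update D j) (state D S js)) \<le> update_time k n D"
  unfolding update_time_def
proof (rule cSup_upper)
  show "bdd_above {card (update_cells (update D j) (state D S js)) | S js j.
      S \<in> inputs k n \<and> set js \<subseteq> {1..n} \<and> j \<in> {1..n}}"
    using card_update_cells_le[OF assms(1)] by (intro bdd_aboveI[of _ "2 ^ w"]) blast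
qed (use assms in blast)

text \<open>Ensures that a set of probed cells can be padded to exactly
  \<open>update_time k n D\<close> cells without leaving the address space. The hypothesis on
  \<open>n\<close> provides one update, so the supremum is over a nonempty set.\<close>

lemma update_time_le:
  assumes "cell_probe_ds w k n D" "n \<ge> 1"
  shows "update_time k n D \<le> 2 ^ w"
  unfolding update_time_def
proof (rule cSup_least)
  obtain S where "S \<in> inputs k n" using inputs_nonempty by blast
  then have "card (update_cells (update D 1) (state D S [])) \<in>
      {card (update_cells (update D j) (state D S js)) | S js j.
        S \<in> inputs k n \<and> set js \<subseteq> {1..n} \<and> j \<in> {1..n}}"
    using assms(2) by fastforce
  then show "{card (update_cells (update D j) (state D S js)) | S js j.
      S \<in> inputs k n \<and> set js \<subseteq> {1..n} \<and> j \<in> {1..n}} \<noteq> {}" by blast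
next
  fix x assume "x \<in> {card (update_cells (update D j) (state D S js)) | S js j.
      S \<in> inputs k n \<and> set js \<subseteq> {1..n} \<and> j \<in> {1..n}}"
  then show "x \<le> 2 ^ w" using card_update_cells_le[OF assms(1)] by blast
qed

text \<open>\<open>U\<close> is the union of the fixed probe sets \<open>P i\<close> of the
  \<open>k\<close> queries. By non-adaptivity the size of each \<open>P i\<close> can be measured at
  a single memory.\<close>

lemma nonadaptive_query_cells:
  assumes ds: "cell_probe_ds w k n D" and na: "nonadaptive_query w k D" and n: "n \<ge> 1"
  obtains U where "U \<subseteq> addresses w" "card U \<le> k * query_time k n D"
    "\<And>i m. i \<in> {1..k} \<Longrightarrow> m \<in> memories w \<Longrightarrow> query_cells (query D i) m \<subseteq> U"
proof -
  obtain P where P: "\<And>i m. i \<in> {1..k} \<Longrightarrow> m \<in> memories w \<Longrightarrow> query_cells (query D i) m = P i"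
    using na unfolding nonadaptive_query_def by metis
  obtain S where S: "S \<in> inputs k n" using inputs_nonempty by blast
  \<comment> \<open>\<open>query_time\<close> only ranges over states reached by at least one
    update, so the sample memory is taken after an update rather than right after
    preprocessing.\<close>
  define m where "m = state D S [1]"
  have m: "m \<in> memories w"
    unfolding m_def using n by (intro state_memories[OF ds S]) auto
  have "P i \<subseteq> addresses w" if "i \<in> {1..k}" for i
    using query_cells_subset_addresses[OF _ m, of "query D i"] P[OF that m] ds that
    by (simp add: cell_probe_ds_def)
  moreover have "card (P i) \<le> query_time k n D" if "i \<in> {1..k}" for i
    using card_query_cells_le_query_time[OF ds S, of "[1]" i] n that P[OF that m] by (simp add: m_def)
  then have "(\<Sum>i\<in>{1..k}. card (P i)) \<le> k * query_time k n D"
    using sum_bounded_above[of "{1..k}" "\<lambda>i. card (P i)" "query_time k n D"] by simp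
  then have "card (\<Union>i\<in>{1..k}. P i) \<le> k * query_time k n D"
    using card_UN_le[of "{1..k}" P] by simp
  ultimately show thesis
    using P by (intro that[of "\<Union>i\<in>{1..k}. P i"] UN_least) blast+
qed

lemma inputs_eqI:
  assumes "S \<in> inputs k n" "S' \<in> inputs k n"
    and "\<And>i j. i \<in> {1..k} \<Longrightarrow> j \<in> {1..n} \<Longrightarrow> S ! (i - 1) ! (j - 1) = S' ! (i - 1) ! (j - 1)"
  shows "S = S'"
proof (rule nth_equalityI)
  show "length S = length S'" using assms(1,2) by (simp add: inputs_def)
  fix i assume i: "i < length S"
  show "S ! i = S' ! i"
  proof (rule nth_equalityI)
    show "length (S ! i) = length (S' ! i)" using assms(1,2) i by (simp add: inputs_def)
    fix j assume "j < length (S ! i)"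
    then show "S ! i ! j = S' ! i ! j"
      using assms(1,2) assms(3)[of "Suc i" "Suc j"] i by (simp add: inputs_def)
  qed
qed

text \<open>Cells that the update does not probe keep their contents. The probed set is padded to a
  size independent of \<open>S\<close> and \<open>j\<close>, so that the possible patches are
  counted by one binomial coefficient.\<close>

lemma update_patch_exists:
  assumes ds: "cell_probe_ds w k n D" and S: "S \<in> inputs k n" and j: "j \<in> {1..n}"
  shows "\<exists>A\<subseteq>addresses w. card A = update_time k n D \<and>
    (\<forall>a. a \<notin> A \<longrightarrow> state D S [j] a = preprocess D S a)"
proof -
  have pre: "state D S [] = preprocess D S" by (simp add: state_def)
  have "update_cells (update D j) (state D S []) \<subseteq> addresses w"
    using ds j state_memories[OF ds S, of "[]"]
    by (intro update_cells_subset_addresses) (auto simp: cell_probe_ds_def)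
  moreover have "card (update_cells (update D j) (state D S [])) \<le> update_time k n D"
    using card_update_cells_le_update_time[OF ds S _ j, of "[]"] by simp
  moreover have "update_time k n D \<le> card (addresses w)"
    using update_time_le[OF ds] j by (simp add: card_addresses)
  ultimately obtain A where "update_cells (update D j) (state D S []) \<subseteq> A"
    "A \<subseteq> addresses w" "card A = update_time k n D"
    using exists_subset_between[OF _ _ _ finite_addresses] by metis
  moreover have "state D S [j] = run_update (update D j) (preprocess D S)"
    by (simp add: state_def)
  ultimately show ?thesis
    using run_update_unprobed pre by (metis subsetD)
qed

lemma indexing_tradeoff:
  assumes solves: "solves_indexing w k n D" and na: "nonadaptive_query w k D" and n: "n \<ge> 1"
  shows "k * n \<le> w * (k * query_time k n D) + 2 * w * update_time k n D * n"
proof -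
  let ?u = "update_time k n D"
  have ds: "cell_probe_ds w k n D" using solves by (simp add: solves_indexing_def)
  have mem: "state D S [j] \<in> memories w" if "S \<in> inputs k n" "j \<in> {1..n}" for S j
    using state_memories[OF ds that(1), of "[j]"] that(2) by simp
  have pre: "preprocess D S \<in> memories w" if "S \<in> inputs k n" for S
    using ds that by (simp add: cell_probe_ds_def)
  obtain U where U: "U \<subseteq> addresses w" "card U \<le> k * query_time k n D"
    "\<And>i m. i \<in> {1..k} \<Longrightarrow> m \<in> memories w \<Longrightarrow> query_cells (query D i) m \<subseteq> U"
    using nonadaptive_query_cells[OF ds na n] by metis
  have finU: "finite U" using U(1) finite_addresses finite_subset by blast
  obtain A where A: "\<And>S j. S \<in> inputs k n \<Longrightarrow> j \<in> {1..n} \<Longrightarrow>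
      A S j \<subseteq> addresses w \<and> card (A S j) = ?u \<and>
      (\<forall>a. a \<notin> A S j \<longrightarrow> state D S [j] a = preprocess D S a)"
    using update_patch_exists[OF ds] by metis

  \<comment> \<open>A patch is the graph of the new memory on \<open>A S j\<close>. Addresses must
    be recorded because updates may be adaptive, so \<open>A S j\<close> can depend on
    \<open>S\<close>.\<close>
  define patch where "patch S j = (\<lambda>a. (a, state D S [j] a)) ` A S j" for S j
  define code where "code S = (restrict (preprocess D S) U, restrict (patch S) {1..n})" for S
  define X where "X = addresses w \<times> words w"
  \<comment> \<open>Only the size of \<open>C\<close> matters: the second component admits all sets
    of \<open>?u\<close> address-content pairs, including those that are not graphs of
    functions.\<close>
  define C where "C = (U \<rightarrow>\<^sub>E words w) \<times> ({1..n} \<rightarrow>\<^sub>E {B. B \<subseteq> X \<and> card B = ?u})"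

  have finX: "finite X" and cardX: "card X = 2 ^ (2 * w)"
    by (simp_all add: X_def finite_addresses finite_words card_cartesian_product card_addresses
        card_words mult_2 flip: power_add)
  have "inj_on code (inputs k n)"
  proof (rule inj_onI)
    fix S S' assume S: "S \<in> inputs k n" and S': "S' \<in> inputs k n" and eq: "code S = code S'"
    show "S = S'"
    proof (rule inputs_eqI[OF S S'])
      fix i j assume i: "i \<in> {1..k}" and j: "j \<in> {1..n}"
      have onU: "preprocess D S a = preprocess D S' a" if "a \<in> U" for a
        using eq that unfolding code_def by (metis prod.inject restrict_apply')
      have patch: "patch S j = patch S' j"
        using eq j unfolding code_def by (metis prod.inject restrict_apply')
      \<comment> \<open>The patched addresses are read off from the patch by projection.\<close>
      then have "fst ` patch S j = fst ` patch S' j" by simp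
      then have A_eq: "A S j = A S' j" by (simp add: patch_def image_image)
      have "state D S [j] a = state D S' [j] a" if "a \<in> U" for a
      \<comment> \<open>A patched cell has its new content listed in the common patch; any other
        cell of \<open>U\<close> still has its content from preprocessing, which the first component
        of the code records.\<close>
      proof (cases "a \<in> A S j")
        case True
        then have "(a, state D S [j] a) \<in> patch S' j"
          using patch unfolding patch_def by blast
        then show ?thesis unfolding patch_def by blast
      next
        case False
        then show ?thesis using A[OF S j] A[OF S' j] A_eq onU[OF that] by metis
      qed
      then have "run_query (query D i) (state D S [j]) = run_query (query D i) (state D S' [j])"
        using U(3)[OF i mem[OF S j]] by (intro run_query_cong) blast
      moreover have "run_query (query D i) (state D T [j]) = T ! (i - 1) ! (j - 1)"
        if "T \<in> inputs k n" for T
      proof -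
        have "[j] \<noteq> [] \<and> set [j] \<subseteq> {1..n}" using j by simp
        then show ?thesis
          using solves i that unfolding solves_indexing_def by (metis last.simps)
      qed
      ultimately show "S ! (i - 1) ! (j - 1) = S' ! (i - 1) ! (j - 1)" using S S' by simp
    qed
  qed
  moreover have "code S \<in> C" if S: "S \<in> inputs k n" for S
  proof -
    have "patch S j \<subseteq> X" "card (patch S j) = ?u" if j: "j \<in> {1..n}" for j
    proof -
      show "patch S j \<subseteq> X"
        using A[OF S j] memories_words[OF mem[OF S j]] by (auto simp: patch_def X_def)
      have "inj_on (\<lambda>a. (a, state D S [j] a)) (A S j)" by (simp add: inj_on_def)
      then show "card (patch S j) = ?u" using A[OF S j] by (simp add: patch_def card_image)
    qed
    then show ?thesis
      using U(1) memories_words[OF pre[OF S]] by (auto simp: code_def C_def)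
  qed
  moreover have "finite C"
    unfolding C_def using finU finX by (intro finite_cartesian_product finite_PiE) (auto simp: finite_words)
  ultimately have "card (inputs k n) \<le> card C"
    by (metis card_inj_on_le image_subsetI)
  also have "card C = (2 ^ w) ^ card U * (card X choose ?u) ^ n"
    by (simp add: C_def card_cartesian_product card_PiE finU card_words n_subsets finX)
  \<comment> \<open>Each patched cell costs a factor \<open>card X\<close>, that is
    \<open>2 * w\<close> bits: \<open>w\<close> for the address and \<open>w\<close> for the
    content.\<close>
  also have "\<dots> \<le> (2 ^ w) ^ (k * query_time k n D) * (card X ^ ?u) ^ n"
  proof (intro mult_le_mono power_mono)
    show "card X choose ?u \<le> card X ^ ?u"
      by (cases "?u \<le> card X") (simp_all add: binomial_le_pow binomial_eq_0)
  qed (use U(2) in \<open>simp_all add: power_increasing\<close>)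
  also have "\<dots> = 2 ^ (w * (k * query_time k n D) + 2 * w * ?u * n)"
    by (simp add: cardX power_add flip: power_mult)
  finally show ?thesis by (simp add: card_inputs)
qed

theorem theorem1:
  "\<exists>c::real. c > 0 \<and>
     (\<forall>(n::nat) (k::nat) (w::nat) (D::indexing_ds).
        w \<ge> 1 \<and> solves_indexing w k n D \<and> nonadaptive_query w k D \<longrightarrow>
          real (query_time k n D) \<ge> c * (real n / real w) \<or>
          real (update_time k n D) \<ge> c * (real k / real w))"
\<comment> \<open>With constant 1/4, failure of both bounds makes the two terms of the tradeoff less
  than \<open>k * n / 4\<close> and \<open>k * n / 2\<close>, which together stay below
  \<open>k * n\<close>.\<close>
proof (intro exI[of _ "1/4"] conjI allI impI)
  fix n k w :: nat and D :: indexing_ds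
  assume *: "w \<ge> 1 \<and> solves_indexing w k n D \<and> nonadaptive_query w k D"
  let ?t = "query_time k n D" and ?u = "update_time k n D"
  show "real ?t \<ge> 1/4 * (real n / real w) \<or> real ?u \<ge> 1/4 * (real k / real w)"
  proof (rule ccontr)
    assume "\<not> ?thesis"
    then have "real (4 * w * ?t) < real n" "real (4 * w * ?u) < real k"
      using * by (simp_all add: field_simps)
    then have t: "4 * w * ?t < n" and u: "4 * w * ?u < k"
      unfolding of_nat_less_iff by blast+
    \<comment> \<open>The strict inequalities \<open>t\<close> and \<open>u\<close> force
      \<open>n\<close> and \<open>k\<close> to be positive, so the degenerate cases are already
      excluded here and in the strict multiplications below.\<close>
    then have "k * n \<le> w * (k * ?t) + 2 * w * ?u * n"
      using * indexing_tradeoff[of w k n D] by simp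
    moreover have "4 * (w * (k * ?t)) < k * n"
      using mult_strict_left_mono[OF t, of k] u by (simp add: mult_ac)
    moreover have "2 * (2 * w * ?u * n) < k * n"
      using mult_strict_right_mono[OF u, of n] t by (simp add: mult_ac)
    ultimately show False by linarith
  qed
qed simp

end
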